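(* Let $\mathbb{K}$ be a field of characteristic zero and let $\mathcal{A}$ be a central arrangement of lines (a $2$-arrangement) in $\mathbb{K}^2$ with $|\mathcal{A}|=h>2$. If a multiplicity $m:\mathcal{A}\rightarrow \mathbb{Z}_{>0}$ is balanced, then $\Delta(m)\le h-2$.
   Context: Let $V=\mathbb{K}^2$, $S=\mathbb{K}[x_1,x_2]$ its coordinate ring, and $\mathrm{Der}(S)=S\partial_{x_1}\oplus S\partial_{x_2}$. A $2$-arrangement $\mathcal{A}$ is a finite set of linear hyperplanes (lines through the origin) in $V$; for each $H\in\mathcal{A}$ fix a linear form $\alpha_H\in V^*$ with $\ker\alpha_H=H$. For a function $m:\mathcal{A}\to\mathbb{Z}_{>0}$ (a multiplicity), the logarithmic derivation module is $$D(\mathcal{A},m)=\{\theta\in\mathrm{Der}(S)\mid \theta(\alpha_H)\in S\cdot\alpha_H^{m(H)}\ \text{for all } H\in\mathcal{A}\}.$$ A nonzero derivation $\theta=f_1\partial_{x_1}+f_2\partial_{x_2}$ is homogeneous of degree $d$ if $f_1,f_2$ are each zero or homogeneous polynomials of degree $d$. In dimension two $D(\mathcal{A},m)$ is always a free $S$-module of rank $2$; if $\theta_1,\theta_2$ is a homogeneous basis, one sets $\exp(\mathcal{A},m)=(d_1,d_2)=(\deg\theta_1,\deg\theta_2)$ and $\Delta(m)=|d_1-d_2|$. The multiplicity $m$ is balanced if $m(K)\le\sum_{H\in\mathcal{A}\setminus\{K\}}m(H)$ for every $K\in\mathcal{A}$. *)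

theory Defs
  imports "HOL-Analysis.Analysis" "HOL-Computational_Algebra.Polynomial"
begin

text \<open>
  The coordinate ring \<open>S = K[x\<^sub>1, x\<^sub>2]\<close> of \<open>V = K\<^sup>2\<close> is represented as
  \<open>(K[x\<^sub>1])[x\<^sub>2]\<close>: the inner variable is \<open>x\<^sub>1\<close>, the outer one is \<open>x\<^sub>2\<close>, so the
  coefficient of \<open>x\<^sub>1\<^sup>i x\<^sub>2\<^sup>j\<close> in \<open>f\<close> is \<open>coeff (coeff f j) i\<close>.
\<close>

type_synonym 'a poly2 = "'a poly poly"

definition X1 :: "'a::field_char_0 poly2" where
  "X1 = [:[:0, 1:]:]"

definition X2 :: "'a::field_char_0 poly2" where
  "X2 = [:0, 1:]"

definition const2 :: "'a::field_char_0 \<Rightarrow> 'a poly2" where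
  "const2 c = [:[:c:]:]"

definition partial1 :: "'a::field_char_0 poly2 \<Rightarrow> 'a poly2" where
  "partial1 f = map_poly pderiv f"

definition partial2 :: "'a::field_char_0 poly2 \<Rightarrow> 'a poly2" where
  "partial2 f = pderiv f"

text \<open>The zero polynomial is homogeneous of every degree in this convention.\<close>

definition homogeneous_poly :: "nat \<Rightarrow> 'a::field_char_0 poly2 \<Rightarrow> bool" where
  "homogeneous_poly d f \<longleftrightarrow> (\<forall>i j. coeff (coeff f j) i \<noteq> 0 \<longrightarrow> i + j = d)"

text \<open>
  \<open>Der S = S \<partial>\<^sub>1 \<oplus> S \<partial>\<^sub>2\<close> is represented by its coefficient vectors, with
  \<open>(*s)\<close> as the \<open>S\<close>-module structure.
\<close>

type_synonym 'a der = "'a poly2 ^ 2"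

definition der_apply :: "'a::field_char_0 der \<Rightarrow> 'a poly2 \<Rightarrow> 'a poly2" where
  "der_apply \<theta> f = \<theta> $ 1 * partial1 f + \<theta> $ 2 * partial2 f"

definition homogeneous_der :: "nat \<Rightarrow> 'a::field_char_0 der \<Rightarrow> bool" where
  "homogeneous_der d \<theta> \<longleftrightarrow> \<theta> \<noteq> 0 \<and> homogeneous_poly d (\<theta> $ 1) \<and> homogeneous_poly d (\<theta> $ 2)"

definition arrangement2 :: "('a::field_char_0 ^ 2) set set \<Rightarrow> bool" where
  "arrangement2 A \<longleftrightarrow> finite A \<and> (\<forall>H\<in>A. vec.subspace H \<and> vec.dim H = 1)"

definition defining_forms ::
  "('a::field_char_0 ^ 2) set set \<Rightarrow> (('a ^ 2) set \<Rightarrow> 'a ^ 2 \<Rightarrow> 'a) \<Rightarrow> bool" where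
  "defining_forms A \<alpha> \<longleftrightarrow>
     (\<forall>H\<in>A. Vector_Spaces.linear (*s) (*) (\<alpha> H) \<and> {v. \<alpha> H v = 0} = H)"

text \<open>The inclusion of the dual space of \<open>V\<close> into \<open>S\<close>.\<close>

definition form_poly :: "('a::field_char_0 ^ 2 \<Rightarrow> 'a) \<Rightarrow> 'a poly2" where
  "form_poly l = const2 (l (axis 1 1)) * X1 + const2 (l (axis 2 1)) * X2"

text \<open>A multiplicity is a function on all sets of vectors; only its values on \<open>A\<close> matter.\<close>

definition multiplicity2 :: "('a::field_char_0 ^ 2) set set \<Rightarrow> (('a ^ 2) set \<Rightarrow> nat) \<Rightarrow> bool" where
  "multiplicity2 A m \<longleftrightarrow> (\<forall>H\<in>A. m H > 0)"

definition balanced :: "('a::field_char_0 ^ 2) set set \<Rightarrow> (('a ^ 2) set \<Rightarrow> nat) \<Rightarrow> bool" where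
  "balanced A m \<longleftrightarrow> (\<forall>K\<in>A. m K \<le> (\<Sum>H\<in>A - {K}. m H))"

definition log_der ::
  "('a::field_char_0 ^ 2) set set \<Rightarrow> (('a ^ 2) set \<Rightarrow> 'a ^ 2 \<Rightarrow> 'a) \<Rightarrow> (('a ^ 2) set \<Rightarrow> nat)
     \<Rightarrow> 'a der set" where
  "log_der A \<alpha> m =
     {\<theta>. \<forall>H\<in>A. form_poly (\<alpha> H) ^ m H dvd der_apply \<theta> (form_poly (\<alpha> H))}"

definition homogeneous_basis ::
  "'a::field_char_0 der set \<Rightarrow> 'a der \<Rightarrow> 'a der \<Rightarrow> nat \<Rightarrow> nat \<Rightarrow> bool" where
  "homogeneous_basis D \<theta>1 \<theta>2 d1 d2 \<longleftrightarrow>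
     homogeneous_der d1 \<theta>1 \<and> homogeneous_der d2 \<theta>2 \<and> \<theta>1 \<noteq> \<theta>2 \<and>
     \<not> module.dependent (*s) {\<theta>1, \<theta>2} \<and> module.span (*s) {\<theta>1, \<theta>2} = D"

text \<open>
  For a 2-arrangement, a homogeneous basis of \<open>log_der A \<alpha> m\<close> always exists, and its degrees
  do not depend on the basis up to order. The choice below therefore only fixes the order of
  the two exponents, and \<open>exponent_gap\<close>, which is \<open>\<Delta>(m)\<close>, does not depend on it.
\<close>

definition exponents ::
  "('a::field_char_0 ^ 2) set set \<Rightarrow> (('a ^ 2) set \<Rightarrow> 'a ^ 2 \<Rightarrow> 'a) \<Rightarrow> (('a ^ 2) set \<Rightarrow> nat)
     \<Rightarrow> nat \<times> nat" where
  "exponents A \<alpha> m =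
     (SOME (d1, d2). \<exists>\<theta>1 \<theta>2. homogeneous_basis (log_der A \<alpha> m) \<theta>1 \<theta>2 d1 d2)"

definition exponent_gap ::
  "('a::field_char_0 ^ 2) set set \<Rightarrow> (('a ^ 2) set \<Rightarrow> 'a ^ 2 \<Rightarrow> 'a) \<Rightarrow> (('a ^ 2) set \<Rightarrow> nat)
     \<Rightarrow> int" where
  "exponent_gap A \<alpha> m = (case exponents A \<alpha> m of (d1, d2) \<Rightarrow> \<bar>int d1 - int d2\<bar>)"

end

(*
  Write |m| for the sum of the multiplicities. Adding one to the multiplicity of one line at a
  time produces a homogeneous basis with d1 + d2 <= |m|, and the sum of the degrees is the same
  for all bases, being the degree of the determinant. It remains to show |m| - h + 2 <= 2 d for
  every homogeneous theta = (f1, f2) of degree d in D(A, m); then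
  |d1 - d2| = d1 + d2 - 2 min(d1, d2) <= h - 2.

  The Jacobian determinant J of (f1, f2) has degree 2 d - 2. Since alpha_H^m(H) divides
  theta(alpha_H), its derivatives are divisible by alpha_H^(m(H) - 1), hence so is J. If J is
  nonzero, then |m| - h <= 2 d - 2. If J = 0, Euler's identity makes the Wronskian of f1 and f2
  vanish, so theta = u * delta for a polynomial u and a constant derivation delta. As delta
  annihilates at most one alpha_K, u is divisible by alpha_H^m(H) for all other H, and
  balancedness gives |m| <= 2 d.
*)
theory Submission
  imports Defs
begin

section \<open>Partial derivatives and constants in K[x1, x2]\<close>

lemma coeff_partial1: "coeff (partial1 f) j = pderiv (coeff f j)"
  by (simp add: partial1_def coeff_map_poly)

lemma coeff_partial2: "coeff (partial2 f) j = of_nat (Suc j) * coeff f (Suc j)"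
  by (simp add: partial2_def coeff_pderiv)

lemma partial1_add: "partial1 (f + g) = partial1 f + partial1 g"
  by (rule poly_eqI) (simp add: coeff_partial1 pderiv_add)

text \<open>Each outer coefficient of a product is a convolution sum, to which the product rule of
  \<open>pderiv\<close> applies term by term.\<close>

lemma partial1_mult: "partial1 (f * g) = partial1 f * g + f * partial1 g"
proof (rule poly_eqI)
  have pderiv_sum: "pderiv (\<Sum>i\<in>I. u i) = (\<Sum>i\<in>I. pderiv (u i))"
    for I :: "nat set" and u :: "nat \<Rightarrow> 'a poly"
    by (induction I rule: infinite_finite_induct) (simp_all add: pderiv_add)
  show "coeff (partial1 (f * g)) n = coeff (partial1 f * g + f * partial1 g) n" for n
    by (simp add: coeff_partial1 coeff_mult pderiv_sum pderiv_mult sum.distrib)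
       (simp add: mult.commute add.commute)
qed

lemma partial2_add: "partial2 (f + g) = partial2 f + partial2 g"
  by (simp add: partial2_def pderiv_add)

lemma partial2_mult: "partial2 (f * g) = partial2 f * g + f * partial2 g"
  by (simp add: partial2_def pderiv_mult algebra_simps)

lemma const2_0 [simp]: "const2 0 = 0"
  and const2_1 [simp]: "const2 1 = 1"
  and const2_eq_0_iff [simp]: "const2 c = 0 \<longleftrightarrow> c = 0"
  and const2_add: "const2 (c + d) = const2 c + const2 d"
  and const2_mult: "const2 (c * d) = const2 c * const2 d"
  by (simp_all add: const2_def one_pCons)

lemma partial_const2 [simp]: "partial1 (const2 c) = 0" "partial2 (const2 c) = 0"
  by (simp_all add: partial1_def partial2_def const2_def map_poly_pCons pderiv_pCons)

lemma partial_X [simp]: "partial1 X1 = 1" "partial2 X1 = 0" "partial1 X2 = 0" "partial2 X2 = 1"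
  by (simp_all add: partial1_def partial2_def X1_def X2_def map_poly_pCons pderiv_pCons one_pCons)

section \<open>Euler's identity and homogeneous polynomials\<close>

text \<open>This is the Euler derivation. It scales every monomial by its total degree, so
  homogeneity becomes an eigenvalue equation.\<close>

definition euler :: "'a::field_char_0 poly2 \<Rightarrow> 'a poly2" where
  "euler f = X1 * partial1 f + X2 * partial2 f"

lemma euler_mult: "euler (f * g) = euler f * g + f * euler g"
  by (simp add: euler_def partial1_mult partial2_mult algebra_simps)

lemma euler_add: "euler (f + g) = euler f + euler g"
  by (simp add: euler_def partial1_add partial2_add algebra_simps)

lemma coeff_euler: "coeff (coeff (euler f) j) i = of_nat (i + j) * coeff (coeff f j) i"
proof -
  have "coeff (coeff (X1 * partial1 f) j) i = of_nat i * coeff (coeff f j) i"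
    by (cases i) (simp_all add: X1_def coeff_partial1 coeff_pderiv)
  moreover have "coeff (coeff (X2 * partial2 f) j) i = of_nat j * coeff (coeff f j) i"
  proof (cases j)
    case (Suc k)
    have "coeff (coeff (X2 * partial2 f) j) i = coeff (of_nat j * coeff f j) i"
      by (simp only: Suc) (simp add: X2_def coeff_partial2 del: of_nat_Suc)
    then show ?thesis by (simp add: of_nat_poly)
  qed (simp add: X2_def)
  ultimately show ?thesis by (simp add: euler_def algebra_simps)
qed

text \<open>In characteristic zero the eigenvalue \<open>of_nat (i + j)\<close> determines the total
  degree. Closure of homogeneity under sums and products then becomes plain algebra, with no
  convolution of coefficients.\<close>

lemma homogeneous_poly_iff_euler: "homogeneous_poly d f \<longleftrightarrow> euler f = of_nat d * f"
proof -
  have "coeff (coeff (of_nat d * f) j) i = of_nat d * coeff (coeff f j) i" for i j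
    by (simp add: of_nat_poly)
  then have "euler f = of_nat d * f \<longleftrightarrow>
      (\<forall>j i. of_nat (i + j) * coeff (coeff f j) i = of_nat d * coeff (coeff f j) i)"
    by (simp only: poly_eq_iff coeff_euler)
  also have "\<dots> \<longleftrightarrow> homogeneous_poly d f"
    unfolding homogeneous_poly_def by (metis mult_cancel_right of_nat_eq_iff)
  finally show ?thesis by simp
qed

lemma homogeneous_poly_0 [simp]: "homogeneous_poly d 0"
  by (simp add: homogeneous_poly_def)

lemma homogeneous_poly_const2 [simp]: "homogeneous_poly 0 (const2 c)"
  by (simp add: homogeneous_poly_iff_euler euler_def)

lemma homogeneous_poly_X [simp]: "homogeneous_poly (Suc 0) X1" "homogeneous_poly (Suc 0) X2"
  by (simp_all add: homogeneous_poly_iff_euler euler_def)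

lemma homogeneous_poly_add:
  "homogeneous_poly d f \<Longrightarrow> homogeneous_poly d g \<Longrightarrow> homogeneous_poly d (f + g)"
  by (simp add: homogeneous_poly_iff_euler euler_add algebra_simps)

lemma homogeneous_poly_minus: "homogeneous_poly d f \<Longrightarrow> homogeneous_poly d (- f)"
  by (simp add: homogeneous_poly_def)

lemma homogeneous_poly_diff:
  "homogeneous_poly d f \<Longrightarrow> homogeneous_poly d g \<Longrightarrow> homogeneous_poly d (f - g)"
  using homogeneous_poly_add[of d f "- g"] homogeneous_poly_minus[of d g] by simp

lemma homogeneous_poly_mult:
  "homogeneous_poly d f \<Longrightarrow> homogeneous_poly e g \<Longrightarrow> homogeneous_poly (d + e) (f * g)"
  by (simp add: homogeneous_poly_iff_euler euler_mult algebra_simps)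

lemma homogeneous_poly_power:
  "homogeneous_poly d f \<Longrightarrow> homogeneous_poly (n * d) (f ^ n)"
proof (induction n)
  case 0
  then show ?case using homogeneous_poly_const2[of 1] by simp
next
  case (Suc n)
  then show ?case using homogeneous_poly_mult[of d f "n * d" "f ^ n"] by simp
qed

lemma homogeneous_poly_prod:
  assumes "\<And>i. i \<in> I \<Longrightarrow> homogeneous_poly (d i) (f i)"
  shows "homogeneous_poly (\<Sum>i\<in>I. d i) (\<Prod>i\<in>I. f i)"
  using assms
proof (induction I rule: infinite_finite_induct)
  case (insert i I)
  then show ?case by (simp add: homogeneous_poly_mult)
qed (use homogeneous_poly_const2[of 1] in simp_all)

lemma homogeneous_poly_partial:
  assumes "homogeneous_poly (Suc d) f"
  shows "homogeneous_poly d (partial1 f)" "homogeneous_poly d (partial2 f)"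
proof -
  show "homogeneous_poly d (partial1 f)"
    using assms unfolding homogeneous_poly_def coeff_partial1 coeff_pderiv
    by (metis Suc_inject add_Suc mult_zero_right)
  have "coeff (coeff (partial2 f) j) i = of_nat (Suc j) * coeff (coeff f (Suc j)) i" for i j
    by (simp add: coeff_partial2 of_nat_poly del: of_nat_Suc)
  then show "homogeneous_poly d (partial2 f)"
    using assms unfolding homogeneous_poly_def
    by (metis Suc_inject add_Suc_right mult_zero_right)
qed

lemma homogeneous_poly_0_imp_const2:
  assumes "homogeneous_poly 0 f"
  obtains c where "f = const2 c"
proof -
  have "f = const2 (coeff (coeff f 0) 0)"
  proof (intro poly_eqI)
    fix i j
    show "coeff (coeff f j) i = coeff (coeff (const2 (coeff (coeff f 0) 0)) j) i"
      using assms unfolding homogeneous_poly_def const2_def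
      by (cases i; cases j) auto
  qed
  then show ?thesis by (rule that)
qed

text \<open>The product rule for \<open>euler\<close> and cancellation of \<open>f\<close> force
  total degree \<open>e - d\<close> on every monomial of \<open>g\<close>. As \<open>g\<close> is
  nonzero, there is such a monomial, and its degree serves as \<open>n\<close>.\<close>

lemma homogeneous_poly_quotient:
  assumes "homogeneous_poly d f" "homogeneous_poly e (f * g)" "f * g \<noteq> 0"
  obtains n where "e = d + n" "homogeneous_poly n g"
proof -
  have "f * (of_nat d * g + euler g - of_nat e * g) = 0"
    using assms(1,2) by (simp add: homogeneous_poly_iff_euler euler_mult algebra_simps)
  then have *: "of_nat d * g + euler g = of_nat e * g" using assms(3) by auto
  have **: "of_nat d * coeff (coeff g j) i + of_nat (i + j) * coeff (coeff g j) i
      = of_nat e * coeff (coeff g j) i" for i j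
    using arg_cong[OF *, of "\<lambda>p. coeff (coeff p j) i"] by (simp add: coeff_euler of_nat_poly)
  have eq: "d + (i + j) = e" if "coeff (coeff g j) i \<noteq> 0" for i j
    using **[of j i] that by (metis mult_cancel_right distrib_right of_nat_add of_nat_eq_iff)
  obtain i j where ij: "coeff (coeff g j) i \<noteq> 0"
    using assms(3) by (metis mult_zero_right leading_coeff_0_iff)
  have "homogeneous_poly (i + j) g"
    unfolding homogeneous_poly_def using eq eq[OF ij] by fastforce
  with that eq[OF ij] show ?thesis by metis
qed

lemma homogeneous_poly_dvd_le:
  assumes "homogeneous_poly d f" "homogeneous_poly e g" "f dvd g" "g \<noteq> 0"
  shows "d \<le> e"
  using assms homogeneous_poly_quotient by (metis dvdE le_add1)

section \<open>Linear forms in two variables\<close>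

definition linear_poly :: "'a::field_char_0 \<Rightarrow> 'a \<Rightarrow> 'a poly2" where
  "linear_poly a b = const2 a * X1 + const2 b * X2"

lemma linear_poly_eq: "linear_poly a b = [:[:0, a:], [:b:]:]"
  by (simp add: linear_poly_def const2_def X1_def X2_def)

lemma linear_poly_eq_0_iff [simp]: "linear_poly a b = 0 \<longleftrightarrow> a = 0 \<and> b = 0"
  by (simp add: linear_poly_eq)

lemma linear_poly_eq_iff: "linear_poly a b = linear_poly c d \<longleftrightarrow> a = c \<and> b = d"
  by (simp add: linear_poly_eq)

lemma const2_mult_linear_poly: "const2 c * linear_poly a b = linear_poly (c * a) (c * b)"
  by (simp add: linear_poly_eq const2_def)

lemma X_eq_linear_poly: "X1 = linear_poly 1 0" "X2 = linear_poly 0 1"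
  by (simp_all add: linear_poly_def)

lemma homogeneous_linear_poly: "homogeneous_poly (Suc 0) (linear_poly a b)"
  unfolding linear_poly_def
  using homogeneous_poly_mult[OF homogeneous_poly_const2 homogeneous_poly_X(1)]
    homogeneous_poly_mult[OF homogeneous_poly_const2 homogeneous_poly_X(2)]
  by (intro homogeneous_poly_add) simp_all

lemma homogeneous_linear_poly_power: "homogeneous_poly n (linear_poly a b ^ n)"
  using homogeneous_poly_power[OF homogeneous_linear_poly, of n a b] by simp

lemma partial_linear_poly [simp]:
  "partial1 (linear_poly a b) = const2 a" "partial2 (linear_poly a b) = const2 b"
  by (simp_all add: linear_poly_def partial1_add partial2_add partial1_mult partial2_mult)

lemma is_unit_const2: "c \<noteq> 0 \<Longrightarrow> const2 c dvd 1"
  by (metis const2_1 const2_mult dvd_def right_inverse)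

text \<open>By degree, the cofactor of a nonzero multiple is a constant, so the coefficient pairs
  are proportional.\<close>

lemma linear_poly_dvd_linear_poly:
  assumes "linear_poly a b dvd linear_poly c d"
  shows "a * d = b * c"
proof (cases "linear_poly c d = 0")
  case False
  from assms obtain k where k: "linear_poly c d = linear_poly a b * k" by (elim dvdE)
  obtain n where "Suc 0 = Suc 0 + n" "homogeneous_poly n k"
    using homogeneous_poly_quotient[OF homogeneous_linear_poly, of "Suc 0" a b k] False
      homogeneous_linear_poly[of c d] unfolding k by blast
  then obtain e where "k = const2 e" using homogeneous_poly_0_imp_const2 by auto
  then have "linear_poly c d = linear_poly (e * a) (e * b)"
    using k by (simp only: mult.commute[of _ "const2 e"] const2_mult_linear_poly)
  then show ?thesis by (simp add: linear_poly_eq_iff)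
qed simp

text \<open>Divisibility by the form amounts to vanishing under a ring homomorphism into a domain: a
  substitution for \<open>X2\<close> if \<open>b\<close> is nonzero, and \<open>X1 = 0\<close>
  otherwise.\<close>

lemma prime_elem_linear_poly:
  assumes "a \<noteq> 0 \<or> b \<noteq> 0"
  shows "prime_elem (linear_poly a b)"
proof (rule prime_elemI)
  show "linear_poly a b \<noteq> 0" using assms by simp
  show "\<not> linear_poly a b dvd 1"
  proof
    assume "linear_poly a b dvd 1"
    moreover have "homogeneous_poly 0 (1 :: 'a poly2)"
      using homogeneous_poly_const2[of 1] by simp
    ultimately show False
      using homogeneous_poly_dvd_le[OF homogeneous_linear_poly, of 0 1 a b] by simp
  qed
  fix f g assume dvd: "linear_poly a b dvd f * g"
  show "linear_poly a b dvd f \<or> linear_poly a b dvd g"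
  proof (cases "b = 0")
    case False
    \<comment> \<open>Over K[x1], \<open>r\<close> is the root of the form as a polynomial in
      x2.\<close>
    define r where "r = [:0, - (a / b):]"
    have "linear_poly a b = const2 b * [:- r, 1:]"
      using False by (simp add: linear_poly_eq const2_def r_def)
    then have "linear_poly a b dvd p \<longleftrightarrow> poly p r = 0" for p
      by (simp only: mult_unit_dvd_iff'[OF is_unit_const2[OF False]] poly_eq_0_iff_dvd)
    with dvd show ?thesis by simp
  next
    case True
    with assms have a: "a \<noteq> 0" by simp
    \<comment> \<open>The notation \<open>[:- 0, 1:]\<close> brings x1 into the shape of the root
      criterion at 0, applied to each inner coefficient.\<close>
    have "linear_poly a b = const2 a * [:[:- 0, 1:]:]"
      using True by (simp add: linear_poly_eq const2_def)
    then have "linear_poly a b dvd p \<longleftrightarrow> (\<forall>n. poly (coeff p n) 0 = 0)" for p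
      by (simp only: mult_unit_dvd_iff'[OF is_unit_const2[OF a]] const_poly_dvd_iff
          poly_eq_0_iff_dvd)
    moreover have "(\<forall>n. poly (coeff p n) 0 = 0) \<longleftrightarrow> map_poly (\<lambda>c. poly c 0) p = 0"
      for p :: "'a poly2"
      by (simp add: poly_eq_iff coeff_map_poly)
    moreover have "map_poly (\<lambda>c. poly c 0) (f * g)
        = map_poly (\<lambda>c. poly c 0) f * map_poly (\<lambda>c. poly c 0) g"
      by (rule poly_eqI) (simp add: coeff_map_poly coeff_mult poly_sum)
    ultimately show ?thesis using dvd by simp
  qed
qed

text \<open>
  Euler's identity expresses \<open>g\<close> through its partial derivatives, whose residues are known by
  induction, and \<open>X1\<close>, \<open>X2\<close>, which are multiples of \<open>linear_poly c d\<close> modulo \<open>linear_poly a b\<close>.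
\<close>

lemma homogeneous_poly_mod_linear_poly:
  assumes "a * d \<noteq> b * c" "homogeneous_poly n g"
  shows "\<exists>k. linear_poly a b dvd g - const2 k * linear_poly c d ^ n"
  using assms(2)
proof (induction n arbitrary: g)
  case 0
  then show ?case by (metis homogeneous_poly_0_imp_const2 dvd_0_right diff_self mult_1_right power_0)
next
  case (Suc n)
  let ?l = "linear_poly a b" and ?e = "linear_poly c d"
  define D where "D = a * d - b * c"
  have D: "D \<noteq> 0" using assms(1) by (simp add: D_def)
  \<comment> \<open>Cramer's rule: modulo \<open>?l\<close>, the variables \<open>X1\<close> and
    \<open>X2\<close> are \<open>q\<close> and \<open>s\<close> times \<open>?e\<close>.\<close>
  define q s where "q = - (b / D)" and "s = a / D"
  have "X1 - const2 q * ?e = ?l * const2 (d / D)" "X2 - const2 s * ?e = ?l * const2 (- (c / D))"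
    using D unfolding mult.commute[of ?l] const2_mult_linear_poly X_eq_linear_poly q_def s_def
    by (simp_all add: linear_poly_eq divide_simps) (simp_all add: D_def algebra_simps)
  then have q: "?l dvd X1 - const2 q * ?e" and s: "?l dvd X2 - const2 s * ?e"
    by simp_all
  obtain k1 where k1: "?l dvd partial1 g - const2 k1 * ?e ^ n"
    using Suc.IH homogeneous_poly_partial(1)[OF Suc.prems] by blast
  obtain k2 where k2: "?l dvd partial2 g - const2 k2 * ?e ^ n"
    using Suc.IH homogeneous_poly_partial(2)[OF Suc.prems] by blast
  have N: "of_nat (Suc n) = const2 (of_nat (Suc n))"
    by (simp add: const2_def of_nat_poly del: of_nat_Suc)
  \<comment> \<open>By Euler's identity the left side starts with \<open>of_nat (Suc n) * g\<close>;
    on the right every summand has a factor divisible by \<open>?l\<close>. The factor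
    \<open>Suc n\<close> is divided out afterwards, in characteristic zero.\<close>
  have "X1 * partial1 g + X2 * partial2 g - const2 (q * k1 + s * k2) * ?e ^ Suc n
      = (X1 - const2 q * ?e) * partial1 g + const2 q * ?e * (partial1 g - const2 k1 * ?e ^ n)
      + ((X2 - const2 s * ?e) * partial2 g + const2 s * ?e * (partial2 g - const2 k2 * ?e ^ n))"
    by (simp add: const2_add const2_mult algebra_simps)
  then have "?l dvd of_nat (Suc n) * g - const2 (q * k1 + s * k2) * ?e ^ Suc n"
    using q s k1 k2 Suc.prems by (simp add: homogeneous_poly_iff_euler euler_def)
  then have "?l dvd const2 (1 / of_nat (Suc n)) *
      (const2 (of_nat (Suc n)) * g - const2 (q * k1 + s * k2) * ?e ^ Suc n)"
    unfolding N by (rule dvd_mult)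
  also have "\<dots> = g - const2 ((q * k1 + s * k2) / of_nat (Suc n)) * ?e ^ Suc n"
    by (simp only: right_diff_distrib mult.assoc[symmetric] const2_mult[symmetric])
       (simp del: of_nat_Suc)
  finally show ?case by blast
qed

section \<open>Divisibility by products of powers of primes\<close>

lemma prime_elem_power_dvd_mult_right:
  fixes p :: "'b::algebraic_semidom"
  assumes "prime_elem p" "\<not> p dvd a" "p ^ n dvd a * b"
  shows "p ^ n dvd b"
  using assms(3)
proof (induction n)
  case (Suc n)
  then have "p ^ n dvd b" by (metis dvd_trans le_imp_power_dvd lessI less_imp_le)
  then obtain c where c: "b = p ^ n * c" by (elim dvdE)
  have "p ^ n * p dvd p ^ n * (a * c)" using Suc.prems by (simp add: c ac_simps)
  then have "p dvd a * c" using assms(1) by (simp add: prime_elem_not_zeroI)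
  then have "p dvd c" using assms(1,2) prime_elem_dvd_multD by blast
  then have "p ^ n * p dvd b" unfolding c by (rule mult_dvd_mono[OF dvd_refl])
  then show ?case by (simp add: mult.commute)
qed simp

text \<open>A new prime divides none of the earlier ones, hence not their product, so its power
  passes to the cofactor \<open>y\<close>. Primality of the given elements replaces unique
  factorization.\<close>

lemma prod_prime_elem_power_dvd:
  fixes p :: "'i \<Rightarrow> 'b::algebraic_semidom"
  assumes "finite I" "\<And>i. i \<in> I \<Longrightarrow> prime_elem (p i)"
    and "\<And>i j. i \<in> I \<Longrightarrow> j \<in> I \<Longrightarrow> i \<noteq> j \<Longrightarrow> \<not> p i dvd p j"
    and "\<And>i. i \<in> I \<Longrightarrow> p i ^ n i dvd x"
  shows "(\<Prod>i\<in>I. p i ^ n i) dvd x"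
  using assms
proof (induction I)
  case (insert i I)
  then obtain y where y: "x = (\<Prod>i\<in>I. p i ^ n i) * y" by (auto elim!: dvdE)
  have "\<not> p i dvd (\<Prod>i\<in>I. p i ^ n i)"
  proof
    assume "p i dvd (\<Prod>i\<in>I. p i ^ n i)"
    then have "p i dvd prod_mset (image_mset (\<lambda>i. p i ^ n i) (mset_set I))"
      by (simp add: prod_unfold_prod_mset)
    then obtain q where "q \<in># image_mset (\<lambda>i. p i ^ n i) (mset_set I)" "p i dvd q"
      using prime_elem_dvd_prod_msetE[OF insert.prems(1)[of i]] by blast
    then obtain j where "j \<in> I" "p i dvd p j ^ n j" using insert.hyps(1) by auto
    moreover from this have "p i dvd p j"
      using insert.prems(1)[of i] prime_elem_dvd_power by blast
    ultimately show False using insert.prems(2)[of i j] insert.hyps(2) by auto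
  qed
  then have "p i ^ n i dvd y"
    using insert.prems(1,3)[of i] prime_elem_power_dvd_mult_right y by blast
  then show ?case using insert.hyps by (simp add: y mult.commute mult_dvd_mono)
qed simp

section \<open>Homogeneous bases of modules of derivations\<close>

text \<open>This is the determinant of Saito's criterion. Its nonvanishing expresses independence
  over S, and for a homogeneous pair its degree is the sum of the two degrees.\<close>

definition der_det :: "'a::field_char_0 der \<Rightarrow> 'a der \<Rightarrow> 'a poly2" where
  "der_det \<theta> \<eta> = \<theta> $ 1 * \<eta> $ 2 - \<theta> $ 2 * \<eta> $ 1"

lemma der_apply_add: "der_apply (\<theta> + \<eta>) f = der_apply \<theta> f + der_apply \<eta> f"
  by (simp add: der_apply_def algebra_simps)

lemma der_apply_diff: "der_apply (\<theta> - \<eta>) f = der_apply \<theta> f - der_apply \<eta> f"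
  by (simp add: der_apply_def algebra_simps)

lemma der_apply_smult: "der_apply (p *s \<theta>) f = p * der_apply \<theta> f"
  by (simp add: der_apply_def algebra_simps)

lemma der_apply_linear_poly:
  "der_apply \<theta> (linear_poly a b) = const2 a * \<theta> $ 1 + const2 b * \<theta> $ 2"
  by (simp add: der_apply_def mult.commute)

lemma homogeneous_poly_der_apply_linear_poly:
  assumes "homogeneous_der d \<theta>"
  shows "homogeneous_poly d (der_apply \<theta> (linear_poly a b))"
proof -
  have "homogeneous_poly d (const2 c * f)" if "homogeneous_poly d f" for c :: 'a and f
    using homogeneous_poly_mult[OF homogeneous_poly_const2 that] by simp
  then show ?thesis
    using assms unfolding der_apply_linear_poly homogeneous_der_def
    by (intro homogeneous_poly_add) simp_all
qed

interpretation der: module "(*s) :: 'a::field_char_0 poly2 \<Rightarrow> 'a der \<Rightarrow> 'a der"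
  by unfold_locales (simp_all add: vec_eq_iff algebra_simps)

lemma der_span_insert2: "der.span {\<theta>, \<eta>} = {p *s \<theta> + q *s \<eta> |p q. True}"
proof (intro equalityI subsetI)
  fix \<zeta> assume "\<zeta> \<in> der.span {\<theta>, \<eta>}"
  then obtain p q where "\<zeta> - p *s \<theta> - q *s \<eta> = 0"
    by (auto simp: der.span_breakdown_eq)
  then have "\<zeta> = p *s \<theta> + q *s \<eta>" by (simp add: algebra_simps)
  then show "\<zeta> \<in> {p *s \<theta> + q *s \<eta> |p q. True}" by blast
next
  fix \<zeta> assume "\<zeta> \<in> {p *s \<theta> + q *s \<eta> |p q. True}"
  then obtain p q where "\<zeta> = p *s \<theta> + q *s \<eta>" by blast
  then show "\<zeta> \<in> der.span {\<theta>, \<eta>}"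
    by (simp add: der.span_add der.span_scale der.span_base)
qed

lemma der_det_smult_left: "der_det (p *s \<theta>) \<eta> = p * der_det \<theta> \<eta>"
  by (simp add: der_det_def algebra_simps)

lemma der_det_diff_smult: "der_det \<theta> (\<eta> - p *s \<theta>) = der_det \<theta> \<eta>"
  by (simp add: der_det_def algebra_simps)

lemma der_det_span:
  "der_det (p *s \<theta> + q *s \<eta>) (r *s \<theta> + s *s \<eta>) = (p * s - q * r) * der_det \<theta> \<eta>"
  by (simp add: der_det_def algebra_simps)

lemma homogeneous_poly_der_det:
  assumes "homogeneous_der d \<theta>" "homogeneous_der e \<eta>"
  shows "homogeneous_poly (d + e) (der_det \<theta> \<eta>)"
  using assms unfolding der_det_def homogeneous_der_def
  by (blast intro: homogeneous_poly_diff homogeneous_poly_mult)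

lemma homogeneous_basis_iff:
  "homogeneous_basis D \<theta> \<eta> d e \<longleftrightarrow>
     homogeneous_der d \<theta> \<and> homogeneous_der e \<eta> \<and> der_det \<theta> \<eta> \<noteq> 0 \<and>
     D = {p *s \<theta> + q *s \<eta> |p q. True}" (is "?L \<longleftrightarrow> ?R")
proof
  assume L: ?L
  then have ne: "\<theta> \<noteq> \<eta>" and ind: "\<not> der.dependent {\<theta>, \<eta>}"
    by (simp_all add: homogeneous_basis_def)
  have indep: "p = 0 \<and> q = 0" if "p *s \<theta> + q *s \<eta> = 0" for p q
  proof -
    define u where "u \<zeta> = (if \<zeta> = \<theta> then p else q)" for \<zeta>
    have "(\<Sum>\<zeta>\<in>{\<theta>, \<eta>}. u \<zeta> *s \<zeta>) = 0" using that ne by (auto simp: u_def)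
    then have "u \<theta> = 0 \<and> u \<eta> = 0" using ind by (auto simp: der.dependent_finite)
    then show ?thesis using ne by (auto simp: u_def)
  qed
  have "der_det \<theta> \<eta> \<noteq> 0"
  proof
    assume "der_det \<theta> \<eta> = 0"
    \<comment> \<open>Both combinations have only zero or plus or minus the determinant as entries,
      so they are relations; independence then kills both entries of \<theta>.\<close>
    then have "\<eta> $ 1 *s \<theta> + (- \<theta> $ 1) *s \<eta> = 0" "\<eta> $ 2 *s \<theta> + (- \<theta> $ 2) *s \<eta> = 0"
      by (auto simp: vec_eq_iff forall_2 der_det_def algebra_simps)
    from this[THEN indep] have "\<theta> = 0" by (simp add: vec_eq_iff forall_2)
    then show False using L by (simp add: homogeneous_basis_def homogeneous_der_def)
  qed
  then show ?R using L by (simp add: homogeneous_basis_def der_span_insert2)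
next
  assume R: ?R
  have "p = 0 \<and> q = 0" if "p *s \<theta> + q *s \<eta> = 0" for p q
  proof -
    have 1: "p * \<theta> $ i + q * \<eta> $ i = 0" for i
      using that by (simp add: vec_eq_iff)
    \<comment> \<open>Cramer's rule for the two coordinate equations in \<open>p\<close> and
      \<open>q\<close>.\<close>
    have "p * der_det \<theta> \<eta> = (p * \<theta> $ 1 + q * \<eta> $ 1) * \<eta> $ 2 - (p * \<theta> $ 2 + q * \<eta> $ 2) * \<eta> $ 1"
      and "q * der_det \<theta> \<eta> = (p * \<theta> $ 2 + q * \<eta> $ 2) * \<theta> $ 1 - (p * \<theta> $ 1 + q * \<eta> $ 1) * \<theta> $ 2"
      by (simp_all add: der_det_def algebra_simps)
    then have "p * der_det \<theta> \<eta> = 0" "q * der_det \<theta> \<eta> = 0" unfolding 1 by simp_all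
    then show ?thesis using R by simp
  qed
  moreover have ne: "\<theta> \<noteq> \<eta>" using R by (auto simp: der_det_def)
  ultimately have "\<not> der.dependent {\<theta>, \<eta>}" by (auto simp: der.dependent_finite)
  with R ne show ?L by (simp add: homogeneous_basis_def der_span_insert2)
qed

lemma homogeneous_basis_commute:
  "homogeneous_basis D \<theta> \<eta> d e \<longleftrightarrow> homogeneous_basis D \<eta> \<theta> e d"
  unfolding homogeneous_basis_def by (metis insert_commute)

text \<open>Writing the second basis in terms of the first makes the first determinant divide the
  second. Exchanging the bases gives equality, so the degree sum is an invariant of
  \<open>D\<close>.\<close>

lemma homogeneous_basis_degree_le:
  assumes "homogeneous_basis D \<theta> \<eta> d e" "homogeneous_basis D \<theta>' \<eta>' d' e'"
  shows "d + e \<le> d' + e'"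
proof -
  have D: "D = {p *s \<theta> + q *s \<eta> |p q. True}" using assms(1) homogeneous_basis_iff by blast
  have "\<theta>' \<in> D" "\<eta>' \<in> D"
    using assms(2) der.span_base[of _ "{\<theta>', \<eta>'}"] by (auto simp: homogeneous_basis_def)
  then have "der_det \<theta> \<eta> dvd der_det \<theta>' \<eta>'" unfolding D by (auto simp: der_det_span)
  then show ?thesis
    using assms unfolding homogeneous_basis_iff
    by (meson homogeneous_poly_der_det homogeneous_poly_dvd_le)
qed

text \<open>
  Raising the multiplicity of one line by \<open>1\<close>: the residues of the two basis values modulo the
  linear form are multiples of powers of a single form, so a multiple of \<open>\<theta>\<close> can be subtracted
  from \<open>\<eta>\<close> to make the residue of \<open>\<eta>\<close> vanish, and \<open>\<theta>\<close> itself is multiplied by the linear form.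
\<close>

lemma homogeneous_basis_refine:
  assumes basis: "homogeneous_basis D \<theta> \<eta> d e" and ab: "a \<noteq> 0 \<or> b \<noteq> 0"
    and le: "\<And>\<zeta>. \<zeta> \<in> D \<Longrightarrow> linear_poly a b ^ n dvd der_apply \<zeta> (linear_poly a b)"
    and nd: "\<not> linear_poly a b ^ Suc n dvd der_apply \<theta> (linear_poly a b)"
    and de: "d \<le> e \<or> linear_poly a b ^ Suc n dvd der_apply \<eta> (linear_poly a b)"
  shows "\<exists>\<theta>' \<eta>'. homogeneous_basis
           {\<zeta> \<in> D. linear_poly a b ^ Suc n dvd der_apply \<zeta> (linear_poly a b)} \<theta>' \<eta>' (Suc d) e"
proof -
  let ?l = "linear_poly a b"
  have prime: "prime_elem ?l" using ab by (rule prime_elem_linear_poly)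
  have D: "D = {p *s \<theta> + q *s \<eta> |p q. True}" and det: "der_det \<theta> \<eta> \<noteq> 0"
    and hom: "homogeneous_der d \<theta>" "homogeneous_der e \<eta>"
    using basis homogeneous_basis_iff by blast+
  have "\<theta> \<in> D" "\<eta> \<in> D"
    using basis der.span_base[of _ "{\<theta>, \<eta>}"] by (auto simp: homogeneous_basis_def)
  then obtain f g where f: "der_apply \<theta> ?l = ?l ^ n * f" and g: "der_apply \<eta> ?l = ?l ^ n * g"
    using le by (meson dvdE)
  have Suc_dvd: "?l ^ Suc n dvd ?l ^ n * h \<longleftrightarrow> ?l dvd h" for h
    using ab by (auto simp: mult.commute[of ?l])
  have "\<not> ?l dvd f" using nd unfolding f Suc_dvd .
  \<comment> \<open>Besides cancelling the residue, \<open>t\<close> has to keep \<eta> homogeneous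
    of degree \<open>e\<close> after the subtraction.\<close>
  have "\<exists>t. ?l dvd g - t * f \<and> homogeneous_poly e (\<eta> $ 1 - t * \<theta> $ 1) \<and>
      homogeneous_poly e (\<eta> $ 2 - t * \<theta> $ 2)"
  proof (cases "?l dvd g")
    case True
    then show ?thesis using hom(2) by (intro exI[of _ 0]) (simp add: homogeneous_der_def)
  next
    case False
    then have "d \<le> e" using de unfolding g Suc_dvd by blast
    have "?l ^ n * f \<noteq> 0" "?l ^ n * g \<noteq> 0" using \<open>\<not> ?l dvd f\<close> False ab by auto
    moreover have "homogeneous_poly d (?l ^ n * f)" "homogeneous_poly e (?l ^ n * g)"
      using homogeneous_poly_der_apply_linear_poly[OF hom(1), of a b]
        homogeneous_poly_der_apply_linear_poly[OF hom(2), of a b]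
      unfolding f g by this
    ultimately obtain d' e' where d': "d = n + d'" "homogeneous_poly d' f"
      and e': "e = n + e'" "homogeneous_poly e' g"
      using homogeneous_poly_quotient[OF homogeneous_linear_poly_power] by metis
    obtain r s where rs: "a * s \<noteq> b * r"
    proof (cases "b = 0")
      case True
      then show ?thesis using ab that[of 1 0] by simp
    next
      case False
      then show ?thesis using that[of 0 1] by simp
    qed
    let ?m = "linear_poly r s"
    obtain k where k: "?l dvd f - const2 k * ?m ^ d'"
      using homogeneous_poly_mod_linear_poly[OF rs d'(2)] by blast
    obtain k' where k': "?l dvd g - const2 k' * ?m ^ e'"
      using homogeneous_poly_mod_linear_poly[OF rs e'(2)] by blast
    have "k \<noteq> 0" using k \<open>\<not> ?l dvd f\<close> by auto
    \<comment> \<open>The constant matches the residues of \<open>t * f\<close> and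
      \<open>g\<close>, and the exponent matches the degrees since \<open>e' = (e - d) + d'\<close>;
      this is where \<open>d \<le> e\<close> enters.\<close>
    define t where "t = const2 (k' / k) * ?m ^ (e - d)"
    have "t * (const2 k * ?m ^ d') = const2 (k' / k * k) * ?m ^ (e - d + d')"
      unfolding t_def const2_mult power_add by (simp add: ac_simps)
    also have "\<dots> = const2 k' * ?m ^ e'" using \<open>k \<noteq> 0\<close> d'(1) e'(1) \<open>d \<le> e\<close> by simp
    finally have "g - t * f = (g - const2 k' * ?m ^ e') - t * (f - const2 k * ?m ^ d')"
      by (simp add: algebra_simps)
    then have "?l dvd g - t * f" using k k' by (metis dvd_diff dvd_mult)
    have "homogeneous_poly (0 + (e - d)) t"
      unfolding t_def
      by (intro homogeneous_poly_mult homogeneous_poly_const2 homogeneous_linear_poly_power)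
    then have "homogeneous_poly e (t * \<theta> $ i)" if "homogeneous_poly d (\<theta> $ i)" for i
      using homogeneous_poly_mult[OF _ that, of "e - d" t] \<open>d \<le> e\<close> by simp
    then have "homogeneous_poly e (\<eta> $ 1 - t * \<theta> $ 1)" "homogeneous_poly e (\<eta> $ 2 - t * \<theta> $ 2)"
      using hom by (simp_all add: homogeneous_poly_diff homogeneous_der_def)
    with \<open>?l dvd g - t * f\<close> show ?thesis by blast
  qed
  then obtain t where t: "?l dvd g - t * f" and ht: "homogeneous_poly e (\<eta> $ 1 - t * \<theta> $ 1)"
      "homogeneous_poly e (\<eta> $ 2 - t * \<theta> $ 2)" by blast
  define \<eta>' where "\<eta>' = \<eta> - t *s \<theta>"
  have det': "der_det (?l *s \<theta>) \<eta>' \<noteq> 0"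
    using det ab by (simp add: \<eta>'_def der_det_diff_smult der_det_smult_left)
  then have "\<eta>' \<noteq> 0" "?l *s \<theta> \<noteq> 0" by (auto simp: der_det_def)
  then have "homogeneous_der e \<eta>'" "homogeneous_der (Suc d) (?l *s \<theta>)"
    using ht hom(1) homogeneous_poly_mult[OF homogeneous_linear_poly, of d _ a b]
    by (simp_all add: homogeneous_der_def \<eta>'_def)
  moreover have "{\<zeta> \<in> D. ?l ^ Suc n dvd der_apply \<zeta> ?l} = {p *s (?l *s \<theta>) + q *s \<eta>' |p q. True}"
  proof (intro equalityI subsetI)
    fix \<zeta> assume "\<zeta> \<in> {\<zeta> \<in> D. ?l ^ Suc n dvd der_apply \<zeta> ?l}"
    then obtain p q where \<zeta>: "\<zeta> = p *s \<theta> + q *s \<eta>" and dvd: "?l ^ Suc n dvd der_apply \<zeta> ?l"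
      unfolding D by blast
    have "der_apply \<zeta> ?l = ?l ^ n * (p * f + q * g)"
      by (simp add: \<zeta> der_apply_add der_apply_smult f g algebra_simps)
    with dvd have "?l dvd p * f + q * g" by (simp only: Suc_dvd)
    \<comment> \<open>The coefficient \<open>p + q * t\<close> of \<theta> with respect to \<theta>
      and \<open>\<eta>'\<close> is isolated; as \<open>?l\<close> is prime and does not divide
      \<open>f\<close>, it must divide this coefficient.\<close>
    moreover have "p * f + q * g = q * (g - t * f) + (p + q * t) * f" by (simp add: algebra_simps)
    ultimately have "?l dvd (p + q * t) * f" using t by (metis dvd_add_right_iff dvd_mult)
    then have "?l dvd p + q * t" using prime \<open>\<not> ?l dvd f\<close> prime_elem_dvd_multD by blast
    then obtain u where u: "p + q * t = ?l * u" by (elim dvdE)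
    have "\<zeta> = (p + q * t) *s \<theta> + q *s \<eta>'"
      by (simp add: \<zeta> \<eta>'_def vec_eq_iff algebra_simps)
    also have "\<dots> = u *s (?l *s \<theta>) + q *s \<eta>'" by (simp add: u mult.commute)
    finally show "\<zeta> \<in> {p *s (?l *s \<theta>) + q *s \<eta>' |p q. True}" by blast
  next
    fix \<zeta> assume "\<zeta> \<in> {p *s (?l *s \<theta>) + q *s \<eta>' |p q. True}"
    then obtain p q where \<zeta>: "\<zeta> = p *s (?l *s \<theta>) + q *s \<eta>'" by blast
    have "\<zeta> = (p * ?l - q * t) *s \<theta> + q *s \<eta>"
      by (simp add: \<zeta> \<eta>'_def vec_eq_iff algebra_simps)
    then have "\<zeta> \<in> D" unfolding D by blast
    moreover have "der_apply \<zeta> ?l = ?l ^ n * (?l * p * f + q * (g - t * f))"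
      by (simp add: \<zeta> \<eta>'_def der_apply_add der_apply_diff der_apply_smult f g algebra_simps)
    then have "?l ^ Suc n dvd der_apply \<zeta> ?l" using t by (simp only: Suc_dvd) simp
    ultimately show "\<zeta> \<in> {\<zeta> \<in> D. ?l ^ Suc n dvd der_apply \<zeta> ?l}" by blast
  qed
  ultimately show ?thesis using det' unfolding homogeneous_basis_iff by blast
qed

section \<open>Existence of a homogeneous basis and the sum of its degrees\<close>

lemma form_poly_eq_linear_poly: "form_poly l = linear_poly (l (axis 1 1)) (l (axis 2 1))"
  by (simp add: form_poly_def linear_poly_def)

text \<open>Induction on the total multiplicity: it starts with the coordinate derivations, of
  degree 0, and raises the multiplicity of one line by one. Each such step adds at most one to the
  degree sum.\<close>

lemma log_der_basis_exists:
  assumes "finite A" "\<And>H. H \<in> A \<Longrightarrow> form_poly (\<alpha> H) \<noteq> 0"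
  shows "\<exists>\<theta> \<eta> d e. homogeneous_basis (log_der A \<alpha> m) \<theta> \<eta> d e \<and> d + e \<le> (\<Sum>H\<in>A. m H)"
proof (induction "\<Sum>H\<in>A. m H" arbitrary: m)
  case 0
  then have "m H = 0" if "H \<in> A" for H using that assms(1) by simp
  then have U: "log_der A \<alpha> m = UNIV" by (simp add: log_der_def)
  have ax: "axis 1 1 $ (2::2) = (0::'a poly2)" "axis 2 1 $ (1::2) = (0::'a poly2)"
    by (simp_all add: axis_def)
  have "homogeneous_poly 0 (1 :: 'a poly2)" using homogeneous_poly_const2[of 1] by simp
  then have "homogeneous_der 0 (axis 1 1 :: 'a der)" "homogeneous_der 0 (axis 2 1 :: 'a der)"
    by (simp_all add: homogeneous_der_def ax axis_eq_0_iff)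
  moreover have "\<zeta> = \<zeta> $ 1 *s axis 1 1 + \<zeta> $ 2 *s axis 2 1" for \<zeta> :: "'a der"
    by (simp add: vec_eq_iff forall_2 ax)
  ultimately have "homogeneous_basis (log_der A \<alpha> m) (axis 1 1) (axis 2 1) 0 0"
    unfolding homogeneous_basis_iff U by (auto simp: der_det_def ax)
  then show ?case using 0 by (metis add_0 le0)
next
  case (Suc n)
  then obtain H where H: "H \<in> A" "m H > 0"
    using sum.neutral[of A m] by fastforce
  define m' where "m' = m(H := m H - 1)"
  have "(\<Sum>K\<in>A. m K) = Suc (\<Sum>K\<in>A. m' K)"
    using H assms(1) by (simp add: m'_def sum.remove[of A H])
  with Suc obtain \<theta> \<eta> d e where basis: "homogeneous_basis (log_der A \<alpha> m') \<theta> \<eta> d e"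
    and de: "Suc (d + e) \<le> (\<Sum>K\<in>A. m K)" by fastforce
  obtain a b where l: "form_poly (\<alpha> H) = linear_poly a b" and ab: "a \<noteq> 0 \<or> b \<noteq> 0"
    using assms(2)[OF H(1)] form_poly_eq_linear_poly by (metis linear_poly_eq_0_iff)
  define D where "D = log_der A \<alpha> m'"
  have m'H: "f ^ m H dvd g \<Longrightarrow> f ^ m' H dvd g" for f g :: "'a poly2"
    by (erule power_le_dvd) (simp add: m'_def)
  have "(\<forall>K\<in>A. form_poly (\<alpha> K) ^ m K dvd der_apply \<zeta> (form_poly (\<alpha> K))) \<longleftrightarrow>
      (\<forall>K\<in>A. form_poly (\<alpha> K) ^ m' K dvd der_apply \<zeta> (form_poly (\<alpha> K))) \<and>
      form_poly (\<alpha> H) ^ m H dvd der_apply \<zeta> (form_poly (\<alpha> H))" for \<zeta>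
    using H(1) m'H by (metis fun_upd_other m'_def)
  moreover have mH: "m H = Suc (m' H)" using H(2) by (simp add: m'_def)
  ultimately have eq: "log_der A \<alpha> m =
      {\<zeta> \<in> D. linear_poly a b ^ Suc (m' H) dvd der_apply \<zeta> (linear_poly a b)}"
    by (auto simp: log_der_def l D_def)
  have le: "linear_poly a b ^ m' H dvd der_apply \<zeta> (linear_poly a b)" if "\<zeta> \<in> D" for \<zeta>
    using that H(1) unfolding D_def log_der_def l[symmetric] by blast
  \<comment> \<open>If both basis elements already satisfy the new condition, the module does not
    change. Otherwise the element to be multiplied by the form is the only one violating the
    condition or, if both do, one of least degree.\<close>
  consider "\<forall>\<zeta>\<in>{\<theta>, \<eta>}. linear_poly a b ^ Suc (m' H) dvd der_apply \<zeta> (linear_poly a b)"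
    | "\<not> linear_poly a b ^ Suc (m' H) dvd der_apply \<theta> (linear_poly a b)"
      "d \<le> e \<or> linear_poly a b ^ Suc (m' H) dvd der_apply \<eta> (linear_poly a b)"
    | "\<not> linear_poly a b ^ Suc (m' H) dvd der_apply \<eta> (linear_poly a b)"
      "e \<le> d \<or> linear_poly a b ^ Suc (m' H) dvd der_apply \<theta> (linear_poly a b)"
    using nle_le[of d e] by blast
  then show ?case
  proof cases
    case 1
    then have "log_der A \<alpha> m = D"
      using basis unfolding eq D_def[symmetric] homogeneous_basis_iff
      by (auto simp: der_apply_add der_apply_smult)
    then show ?thesis using basis de unfolding D_def by (metis Suc_leD)
  next
    case 2
    then obtain \<theta>' \<eta>' where "homogeneous_basis (log_der A \<alpha> m) \<theta>' \<eta>' (Suc d) e"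
      using homogeneous_basis_refine[OF basis[folded D_def] ab le] unfolding eq by blast
    moreover have "Suc d + e \<le> (\<Sum>K\<in>A. m K)" using de by simp
    ultimately show ?thesis by blast
  next
    case 3
    have "homogeneous_basis D \<eta> \<theta> e d" using basis homogeneous_basis_commute D_def by blast
    from homogeneous_basis_refine[OF this ab le 3]
    obtain \<theta>' \<eta>' where "homogeneous_basis (log_der A \<alpha> m) \<theta>' \<eta>' (Suc e) d"
      unfolding eq by blast
    moreover have "Suc e + d \<le> (\<Sum>K\<in>A. m K)" using de by simp
    ultimately show ?thesis by blast
  qed
qed

section \<open>The Jacobian of a logarithmic derivation\<close>

lemma lead_coeff_pderiv:
  fixes p :: "'b::{idom, ring_char_0} poly"
  shows "lead_coeff (pderiv p) = of_nat (degree p) * lead_coeff p"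
proof (cases "degree p")
  case 0
  then show ?thesis by (simp add: pderiv_eq_0_iff)
qed (simp add: degree_pderiv coeff_pderiv)

text \<open>The leading coefficients of the two products differ only in the factors
  \<open>degree q\<close> and \<open>degree p\<close>, which characteristic zero allows to be
  compared.\<close>

lemma degree_eq_if_wronskian_eq_0:
  fixes p q :: "'b::{idom, ring_char_0} poly"
  assumes "p * pderiv q = q * pderiv p" "p \<noteq> 0" "q \<noteq> 0"
  shows "degree p = degree q"
proof -
  have "lead_coeff p * (of_nat (degree q) * lead_coeff q)
      = lead_coeff q * (of_nat (degree p) * lead_coeff p)"
    using arg_cong[OF assms(1), of lead_coeff] by (simp only: lead_coeff_mult lead_coeff_pderiv)
  then have "(lead_coeff p * lead_coeff q) * of_nat (degree q)
      = (lead_coeff p * lead_coeff q) * of_nat (degree p)"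
    by (simp add: ac_simps)
  then show ?thesis using assms(2,3) by simp
qed

text \<open>Only the power \<open>d - j\<close> of x1 can accompany the power \<open>j\<close> of
  x2. For \<open>j > d\<close> the subtraction truncates, but then both sides are zero.\<close>

lemma homogeneous_poly_coeff_eq_monom:
  assumes "homogeneous_poly d f"
  shows "coeff f j = monom (coeff (coeff f j) (d - j)) (d - j)"
  using assms by (intro poly_eqI) (fastforce simp: homogeneous_poly_def)

text \<open>
  With \<open>c\<close>, \<open>e\<close> chosen so that the coefficients at the highest power of \<open>X2\<close> cancel in
  \<open>c f - e g\<close>, this difference still has zero Wronskian with \<open>g\<close>, but a lower degree in \<open>X2\<close>.
\<close>

lemma homogeneous_poly_proportional:
  assumes hom: "homogeneous_poly d f" "homogeneous_poly d g"
    and wronskian: "f * partial2 g = g * partial2 f"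
  shows "\<exists>c e. (c \<noteq> 0 \<or> e \<noteq> 0) \<and> const2 c * f = const2 e * g"
proof (cases "f = 0 \<or> g = 0")
  case True
  then show ?thesis by (metis const2_0 const2_1 mult_zero_left mult_zero_right one_neq_zero)
next
  case False
  define n where "n = degree f"
  have n: "degree g = n"
    using degree_eq_if_wronskian_eq_0[of f g] wronskian False by (simp add: partial2_def n_def)
  define c e where "c = coeff (coeff g n) (d - n)" and "e = coeff (coeff f n) (d - n)"
  have lf: "coeff f n = monom e (d - n)" and lg: "coeff g n = monom c (d - n)"
    unfolding c_def e_def using hom homogeneous_poly_coeff_eq_monom by blast+
  have "coeff f n \<noteq> 0" using False by (simp add: n_def)
  then have "e \<noteq> 0" using lf by auto
  define u where "u = const2 c * f - const2 e * g"
  have "coeff u n = 0"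
    by (simp add: u_def lf lg const2_def smult_monom mult.commute)
  have "degree u \<le> n"
    unfolding u_def const2_def using n by (intro degree_diff_le) (simp_all add: n_def)
  have pu: "pderiv u = const2 c * partial2 f - const2 e * partial2 g"
    by (simp add: u_def partial2_def const2_def pderiv_diff pderiv_smult)
  have "u * pderiv g = const2 c * (f * partial2 g) - const2 e * (g * partial2 g)"
    by (simp add: u_def partial2_def algebra_simps)
  also have "\<dots> = const2 c * (g * partial2 f) - const2 e * (g * partial2 g)"
    by (simp only: wronskian)
  also have "\<dots> = g * pderiv u" unfolding pu by (simp add: algebra_simps)
  finally have "u * pderiv g = g * pderiv u" .
  \<comment> \<open>A nonzero \<open>u\<close> would have degree exactly \<open>n\<close>, but its
    coefficient there has been cancelled.\<close>
  then have "u = 0 \<or> degree u = n"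
    using degree_eq_if_wronskian_eq_0[of u g] False n by blast
  then have "u = 0" using \<open>coeff u n = 0\<close> by auto
  then have "const2 c * f = const2 e * g" by (simp add: u_def)
  with \<open>e \<noteq> 0\<close> show ?thesis by blast
qed

text \<open>The product rule costs at most one factor \<open>p\<close>. An abstract \<open>D\<close>
  serves both partial derivatives.\<close>

lemma power_dvd_derivation:
  fixes D :: "'b::comm_ring_1 \<Rightarrow> 'b"
  assumes D: "\<And>f g. D (f * g) = D f * g + f * D g" and "p ^ Suc n dvd f"
  shows "p ^ n dvd D f"
proof -
  have "p ^ n dvd D (p ^ Suc n)"
  proof (induction n)
    case (Suc n)
    have "D (p ^ Suc (Suc n)) = D p * p ^ Suc n + p * D (p ^ Suc n)"
      using D[of p "p ^ Suc n"] by simp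
    moreover have "p ^ Suc n dvd p * D (p ^ Suc n)" using Suc by (simp add: mult_dvd_mono)
    ultimately show ?case by simp
  qed simp
  moreover obtain g where "f = p ^ Suc n * g" using assms(2) by (elim dvdE)
  ultimately show ?thesis by (simp add: D dvd_mult le_imp_power_dvd)
qed

definition jacobian :: "'a::field_char_0 der \<Rightarrow> 'a poly2" where
  "jacobian \<theta> = partial1 (\<theta> $ 1) * partial2 (\<theta> $ 2) - partial2 (\<theta> $ 1) * partial1 (\<theta> $ 2)"

lemma linear_poly_power_dvd_jacobian:
  assumes ab: "a \<noteq> 0 \<or> b \<noteq> 0"
    and dvd: "linear_poly a b ^ Suc n dvd der_apply \<theta> (linear_poly a b)"
  shows "linear_poly a b ^ n dvd jacobian \<theta>"
proof -
  let ?l = "linear_poly a b" and ?g = "der_apply \<theta> (linear_poly a b)"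
  have 1: "?l ^ n dvd partial1 ?g" and 2: "?l ^ n dvd partial2 ?g"
    using power_dvd_derivation[OF _ dvd] partial1_mult partial2_mult by blast+
  have p1: "partial1 ?g = const2 a * partial1 (\<theta> $ 1) + const2 b * partial1 (\<theta> $ 2)"
    and p2: "partial2 ?g = const2 a * partial2 (\<theta> $ 1) + const2 b * partial2 (\<theta> $ 2)"
    unfolding der_apply_linear_poly
    by (simp_all add: partial1_add partial2_add partial1_mult partial2_mult)
  \<comment> \<open>Eliminating one component of \<theta> from the two partial derivatives leaves
    \<open>a\<close> or \<open>b\<close> times the Jacobian; one of these constants is a
    unit.\<close>
  have "const2 a * jacobian \<theta> = partial1 ?g * partial2 (\<theta> $ 2) - partial2 ?g * partial1 (\<theta> $ 2)"
    and "const2 b * jacobian \<theta> = partial2 ?g * partial1 (\<theta> $ 1) - partial1 ?g * partial2 (\<theta> $ 1)"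
    unfolding p1 p2 jacobian_def by (simp_all add: algebra_simps)
  then have "?l ^ n dvd const2 a * jacobian \<theta>" "?l ^ n dvd const2 b * jacobian \<theta>"
    using 1 2 by simp_all
  then show ?thesis
    using ab is_unit_const2 dvd_mult_unit_iff' by blast
qed

text \<open>Constant coefficients have zero Jacobian, so \<open>d\<close> is positive; writing it as
  \<open>Suc d'\<close> avoids truncated subtraction in the degree \<open>2 * d - 2\<close>.\<close>

lemma homogeneous_poly_jacobian:
  assumes "homogeneous_der d \<theta>" "jacobian \<theta> \<noteq> 0"
  obtains d' where "d = Suc d'" "homogeneous_poly (d' + d') (jacobian \<theta>)"
proof (cases d)
  case 0
  then show ?thesis
    using assms homogeneous_poly_0_imp_const2[of "\<theta> $ 1"]
    by (metis diff_self homogeneous_der_def jacobian_def mult_zero_left partial_const2)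
next
  case (Suc d')
  then have "homogeneous_poly (d' + d') (jacobian \<theta>)"
    using assms(1) unfolding jacobian_def homogeneous_der_def
    by (intro homogeneous_poly_diff homogeneous_poly_mult homogeneous_poly_partial) simp_all
  then show ?thesis using Suc that by blast
qed

lemma jacobian_eq_0_imp_multiple:
  assumes hom: "homogeneous_der d \<theta>" and J: "jacobian \<theta> = 0"
  obtains r s u where "r \<noteq> 0 \<or> s \<noteq> 0" "u \<noteq> 0" "homogeneous_poly d u"
    "\<theta> $ 1 = const2 r * u" "\<theta> $ 2 = const2 s * u"
proof -
  let ?f = "\<theta> $ 1" and ?g = "\<theta> $ 2"
  have f: "homogeneous_poly d ?f" and g: "homogeneous_poly d ?g" and ne: "\<theta> \<noteq> 0"
    using hom by (auto simp: homogeneous_der_def)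
  have "?f * partial2 ?g = ?g * partial2 ?f"
  proof (cases "d = 0")
    case True
    then have "partial2 ?f = 0" "partial2 ?g = 0"
      using f g homogeneous_poly_0_imp_const2 partial_const2(2) by metis+
    then show ?thesis by simp
  next
    case False
    \<comment> \<open>In the Euler expansions the \<open>X2\<close> terms cancel. Recovering the
      Wronskian requires division by \<open>d\<close>, hence the separate case
      \<open>d = 0\<close>.\<close>
    have "of_nat d * (?f * partial2 ?g - ?g * partial2 ?f)
        = euler ?f * partial2 ?g - euler ?g * partial2 ?f"
      using f g by (simp add: homogeneous_poly_iff_euler algebra_simps)
    also have "\<dots> = X1 * jacobian \<theta>" by (simp add: euler_def jacobian_def algebra_simps)
    finally show ?thesis using J False by simp
  qed
  then obtain c e where ce: "c \<noteq> 0 \<or> e \<noteq> 0" and eq: "const2 c * ?f = const2 e * ?g"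
    using homogeneous_poly_proportional[OF f g] by blast
  show ?thesis
  proof (cases "c = 0")
    case True
    then have "?g = 0" using ce eq by simp
    moreover from this have "?f \<noteq> 0" using ne by (auto simp: vec_eq_iff forall_2)
    ultimately show ?thesis using that[of 1 0 ?f] f by simp
  next
    case False
    have "?f = const2 (1 / c * c) * ?f" using False by simp
    also have "\<dots> = const2 (1 / c) * (const2 e * ?g)"
      unfolding const2_mult by (simp only: mult.assoc eq)
    also have "\<dots> = const2 (e / c) * ?g"
      by (simp only: mult.assoc[symmetric] const2_mult[symmetric]) simp
    finally have "?f = const2 (e / c) * ?g" .
    moreover from this have "?g \<noteq> 0" using ne by (auto simp: vec_eq_iff forall_2)
    ultimately show ?thesis using that[of "e / c" 1 ?g] g by simp
  qed
qed

section \<open>Lower bound for the degree of a logarithmic derivation\<close>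

lemma balanced_degree_bound:
  fixes a b :: "'i \<Rightarrow> 'a::field_char_0"
  assumes A: "finite A" "card A \<ge> 2"
    and indep: "\<And>H K. H \<in> A \<Longrightarrow> K \<in> A \<Longrightarrow> H \<noteq> K \<Longrightarrow> a H * b K \<noteq> b H * a K"
    and pos: "\<And>H. H \<in> A \<Longrightarrow> m H > 0"
    and bal: "\<And>K. K \<in> A \<Longrightarrow> m K \<le> (\<Sum>H\<in>A - {K}. m H)"
    and hom: "homogeneous_der d \<theta>"
    and dvd: "\<And>H. H \<in> A \<Longrightarrow>
      linear_poly (a H) (b H) ^ m H dvd der_apply \<theta> (linear_poly (a H) (b H))"
  shows "(\<Sum>H\<in>A. m H) + 2 \<le> 2 * d + card A"
proof -
  let ?l = "\<lambda>H. linear_poly (a H) (b H)"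
  have ab: "a H \<noteq> 0 \<or> b H \<noteq> 0" if "H \<in> A" for H
  proof -
    obtain K where "K \<in> A" "K \<noteq> H"
      using A that by (metis One_nat_def card_le_Suc0_iff_eq not_less_eq_eq numeral_2_eq_2)
    then show ?thesis using indep[OF that, of K] by auto
  qed
  have prime: "prime_elem (?l H)" if "H \<in> A" for H
    using ab[OF that] by (rule prime_elem_linear_poly)
  have ndvd: "\<not> ?l H dvd ?l K" if "H \<in> A" "K \<in> A" "H \<noteq> K" for H K
    using linear_poly_dvd_linear_poly indep that by blast
  \<comment> \<open>Forms of distinct lines are non-associated primes, so the product of their
    powers divides \<open>u\<close>, and degrees can be compared.\<close>
  have bound: "(\<Sum>H\<in>I. k H) \<le> n"
    if "I \<subseteq> A" "homogeneous_poly n u" "u \<noteq> 0" "\<And>H. H \<in> I \<Longrightarrow> ?l H ^ k H dvd u" for I k n u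
  proof (rule homogeneous_poly_dvd_le)
    show "homogeneous_poly (\<Sum>H\<in>I. k H) (\<Prod>H\<in>I. ?l H ^ k H)"
      by (intro homogeneous_poly_prod homogeneous_linear_poly_power)
    show "(\<Prod>H\<in>I. ?l H ^ k H) dvd u"
    proof (rule prod_prime_elem_power_dvd)
      show "finite I" using that(1) A(1) by (rule finite_subset)
    qed (use that(1,4) prime ndvd in blast)+
  qed (use that in auto)
  show ?thesis
  proof (cases "jacobian \<theta> = 0")
    case False
    then obtain d' where d': "d = Suc d'" and hJ: "homogeneous_poly (d' + d') (jacobian \<theta>)"
      using hom homogeneous_poly_jacobian by blast
    have "?l H ^ (m H - 1) dvd jacobian \<theta>" if "H \<in> A" for H
      using linear_poly_power_dvd_jacobian[OF ab[OF that], of "m H - 1"] dvd[OF that] pos[OF that]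
      by simp
    then have "(\<Sum>H\<in>A. m H - 1) \<le> d' + d'" by (intro bound[OF subset_refl hJ False])
    \<comment> \<open>Positivity makes the subtraction exact, so lowering every multiplicity by one
      loses exactly \<open>card A\<close>.\<close>
    moreover have "(\<Sum>H\<in>A. m H) = (\<Sum>H\<in>A. (m H - 1) + 1)"
      using pos by (intro sum.cong) (auto simp: Suc_leI)
    then have "(\<Sum>H\<in>A. m H) = (\<Sum>H\<in>A. m H - 1) + card A"
      by (simp only: sum.distrib) simp
    ultimately show ?thesis by (simp add: d')
  next
    case True
    then obtain r s u where rs: "r \<noteq> 0 \<or> s \<noteq> 0" and u: "u \<noteq> 0" "homogeneous_poly d u"
      and \<theta>: "\<theta> $ 1 = const2 r * u" "\<theta> $ 2 = const2 s * u"
      using hom jacobian_eq_0_imp_multiple by metis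
    have app: "der_apply \<theta> (?l H) = const2 (a H * r + b H * s) * u" for H
      by (simp add: der_apply_linear_poly \<theta> const2_add const2_mult algebra_simps)
    \<comment> \<open>The constant derivation with coefficients \<open>r\<close> and
      \<open>s\<close> kills at most one form: if it killed two, their nonzero determinant would
      force \<open>r = s = 0\<close>.\<close>
    have "\<exists>K\<in>A. \<forall>H\<in>A - {K}. a H * r + b H * s \<noteq> 0"
    proof (rule ccontr)
      assume neg: "\<not> ?thesis"
      obtain K0 where "K0 \<in> A" using A by fastforce
      with neg obtain H where H: "H \<in> A" "a H * r + b H * s = 0" by blast
      with neg obtain K where K: "K \<in> A" "K \<noteq> H" "a K * r + b K * s = 0" by blast
      have "(a H * b K - b H * a K) * r = b K * (a H * r + b H * s) - b H * (a K * r + b K * s)"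
        and "(a H * b K - b H * a K) * s = a H * (a K * r + b K * s) - a K * (a H * r + b H * s)"
        by (simp_all add: algebra_simps)
      then show False using H K rs indep[of H K] by auto
    qed
    then obtain K where K: "K \<in> A" "\<And>H. H \<in> A - {K} \<Longrightarrow> a H * r + b H * s \<noteq> 0" by blast
    have "?l H ^ m H dvd u" if "H \<in> A - {K}" for H
      using dvd[of H] that is_unit_const2[OF K(2)[OF that]]
      unfolding app by (simp add: dvd_mult_unit_iff')
    then have "(\<Sum>H\<in>A - {K}. m H) \<le> d" by (intro bound[OF _ u(2,1)]) auto
    moreover have "(\<Sum>H\<in>A. m H) = m K + (\<Sum>H\<in>A - {K}. m H)"
      using A(1) K(1) by (rule sum.remove)
    \<comment> \<open>Balancedness bounds the total by twice the sum without \<open>K\<close>, hence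
      by \<open>2 * d\<close>; \<open>card A \<ge> 2\<close> absorbs the summand 2.\<close>
    ultimately show ?thesis using bal[OF K(1)] A(2) by simp
  qed
qed

section \<open>From lines to the coordinates of their forms\<close>

lemma linear_form_eq_coordinates:
  fixes l :: "'a::field_char_0 ^ 2 \<Rightarrow> 'a"
  assumes "Vector_Spaces.linear (*s) (*) l"
  shows "l v = v $ 1 * l (axis 1 1) + v $ 2 * l (axis 2 1)"
proof -
  interpret l: Vector_Spaces.linear "(*s)" "(*)" l by fact
  have "v = v $ 1 *s axis 1 1 + v $ 2 *s axis 2 1"
    by (simp add: vec_eq_iff forall_2 axis_def)
  then have "l v = l (v $ 1 *s axis 1 1 + v $ 2 *s axis 2 1)" by simp
  then show ?thesis by (simp only: l.add l.scale)
qed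

text \<open>Proportional nonzero forms have the same kernel, so they define the same line. A form is
  nonzero because its kernel has dimension 1 and not 2.\<close>

lemma defining_forms_independent:
  fixes A :: "('a::field_char_0 ^ 2) set set"
  assumes A: "arrangement2 A" "defining_forms A \<alpha>" and HK: "H \<in> A" "K \<in> A" "H \<noteq> K"
  shows "\<alpha> H (axis 1 1) * \<alpha> K (axis 2 1) \<noteq> \<alpha> H (axis 2 1) * \<alpha> K (axis 1 1)"
proof
  define a b where "a L = \<alpha> L (axis 1 1)" and "b L = \<alpha> L (axis 2 1)" for L
  assume "\<alpha> H (axis 1 1) * \<alpha> K (axis 2 1) = \<alpha> H (axis 2 1) * \<alpha> K (axis 1 1)"
  then have det: "a H * b K = b H * a K" by (simp add: a_def b_def)
  have L: "L = {v. v $ 1 * a L + v $ 2 * b L = 0}" if "L \<in> A" for L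
    using A(2) that linear_form_eq_coordinates unfolding defining_forms_def a_def b_def
    by (metis (mono_tags, lifting) Collect_cong)
  have ne: "a L \<noteq> 0 \<or> b L \<noteq> 0" if "L \<in> A" for L
  proof (rule ccontr)
    assume "\<not> ?thesis"
    then have "L = UNIV" using L[OF that] by simp
    moreover have "vec.dim L = 1" using A(1) that by (simp add: arrangement2_def)
    ultimately show False using vec_dim_card[where ?'a = 'a and ?'n = 2] by simp
  qed
  have sub: "L \<subseteq> M" if "L \<in> A" "M \<in> A" "a L * b M = b L * a M" for L M
  proof
    fix v assume "v \<in> L"
    then have v: "v $ 1 * a L + v $ 2 * b L = 0" using L[OF that(1)] by blast
    \<comment> \<open>The value of the form of \<open>M\<close> at \<open>v\<close> vanishes after
      multiplication by \<open>a L\<close> and by \<open>b L\<close>, one of which is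
      nonzero.\<close>
    have "a L * (v $ 1 * a M + v $ 2 * b M)
        = a M * (v $ 1 * a L + v $ 2 * b L) + v $ 2 * (a L * b M - b L * a M)"
      and "b L * (v $ 1 * a M + v $ 2 * b M)
        = b M * (v $ 1 * a L + v $ 2 * b L) - v $ 1 * (a L * b M - b L * a M)"
      by (simp_all add: algebra_simps)
    then have "v $ 1 * a M + v $ 2 * b M = 0" using v that(3) ne[OF that(1)] by auto
    then show "v \<in> M" using L[OF that(2)] by blast
  qed
  have "H = K" using sub[OF HK(1,2)] sub[OF HK(2,1)] det by (auto simp: mult.commute)
  with HK(3) show False ..
qed

theorem theorem0p1:
  fixes A :: "('a::field_char_0 ^ 2) set set"
    and \<alpha> :: "('a ^ 2) set \<Rightarrow> 'a ^ 2 \<Rightarrow> 'a"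
    and m :: "('a ^ 2) set \<Rightarrow> nat"
    and h :: nat
  assumes "arrangement2 A"
    and "defining_forms A \<alpha>"
    and "card A = h" and "h > 2"
    and "multiplicity2 A m"
    and "balanced A m"
  shows "exponent_gap A \<alpha> m \<le> int h - 2"
proof -
  have fin: "finite A" using assms(1) by (simp add: arrangement2_def)
  have indep: "\<And>H K. H \<in> A \<Longrightarrow> K \<in> A \<Longrightarrow> H \<noteq> K \<Longrightarrow>
      \<alpha> H (axis 1 1) * \<alpha> K (axis 2 1) \<noteq> \<alpha> H (axis 2 1) * \<alpha> K (axis 1 1)"
    using defining_forms_independent[OF assms(1,2)] .
  have nz: "form_poly (\<alpha> H) \<noteq> 0" if "H \<in> A" for H
  proof -
    have "\<not> A \<subseteq> {H}" using assms(3,4) card_mono[of "{H}" A] by auto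
    then obtain K where "K \<in> A" "K \<noteq> H" by blast
    then show ?thesis using indep[OF that, of K] by (auto simp: form_poly_eq_linear_poly)
  qed
  obtain \<theta>' \<eta>' d' e'
    where basis': "homogeneous_basis (log_der A \<alpha> m) \<theta>' \<eta>' d' e'"
      and le: "d' + e' \<le> (\<Sum>H\<in>A. m H)"
    using log_der_basis_exists[OF fin, of \<alpha> m] nz by blast
  obtain d e where de: "exponents A \<alpha> m = (d, e)" by (cases "exponents A \<alpha> m")
  \<comment> \<open>Existence of some basis ensures that the pair selected by \<open>SOME\<close> is
    the degree pair of an actual basis.\<close>
  have "\<exists>x. case x of (d, e) \<Rightarrow> \<exists>\<theta> \<eta>. homogeneous_basis (log_der A \<alpha> m) \<theta> \<eta> d e"
    using basis' by blast
  from someI_ex[OF this] obtain \<theta> \<eta> where basis: "homogeneous_basis (log_der A \<alpha> m) \<theta> \<eta> d e"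
    using de unfolding exponents_def by auto
  have "\<theta> \<in> log_der A \<alpha> m" "\<eta> \<in> log_der A \<alpha> m"
    using basis der.span_base[of _ "{\<theta>, \<eta>}"] by (auto simp: homogeneous_basis_def)
  moreover have "(\<Sum>H\<in>A. m H) + 2 \<le> 2 * n + card A"
    if "\<zeta> \<in> log_der A \<alpha> m" "homogeneous_der n \<zeta>" for \<zeta> n
  proof (rule balanced_degree_bound[OF fin _ indep _ _ that(2)])
    show "\<And>H. H \<in> A \<Longrightarrow> linear_poly (\<alpha> H (axis 1 1)) (\<alpha> H (axis 2 1)) ^ m H dvd
        der_apply \<zeta> (linear_poly (\<alpha> H (axis 1 1)) (\<alpha> H (axis 2 1)))"
      using that(1) by (simp add: log_der_def form_poly_eq_linear_poly)
  qed (use assms in \<open>simp_all add: multiplicity2_def balanced_def\<close>)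
  ultimately have "(\<Sum>H\<in>A. m H) + 2 \<le> 2 * d + h" "(\<Sum>H\<in>A. m H) + 2 \<le> 2 * e + h"
    using basis assms(3) by (simp_all add: homogeneous_basis_def)
  moreover have "d + e \<le> (\<Sum>H\<in>A. m H)"
    using homogeneous_basis_degree_le[OF basis basis'] le by simp
  \<comment> \<open>The gap is \<open>d + e\<close> minus twice the smaller exponent; the bounds on
    both give \<open>h - 2\<close> whichever is smaller.\<close>
  ultimately show ?thesis by (simp add: exponent_gap_def de)
qed

end
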